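(* There is a positive absolute constant $c$ such that the following holds. Fix an integer $k\ge 2$, and let $S$ be a sequence of $k$ independently chosen (uniformly) random elements of the symmetric group $G=S_n$. Then the girth of the directed Cayley graph $\Gamma^*(G,S)$ exceeds $c\sqrt{\log_k |G|}$ almost surely, i.e. with probability tending to $1$ as $n\to\infty$.
   Context: For a finite group $G$ and a sequence $S=(g_1,\dots,g_k)$ of elements of $G$, $\Gamma^*(G,S)$ is the associated directed Cayley graph: the vertex set is $G$, and there is a directed edge from $x$ to $xg_i$ for each $x\in G$ and $1\le i\le k$. The girth of a directed graph is the minimal length of a directed cycle in it. *)

theory Defs
  imports
    "HOL-Probability.Probability"
    "HOL-Algebra.Sym_Groups"
    "Graph_Theory.Arc_Walk"
begin

text \<open>
  The arc \<open>(x, i)\<close> runs from \<open>x\<close> to \<open>x \<otimes> S ! i\<close>. Arcs carry the index of their generator, so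
  repeated entries of \<open>S\<close> give parallel arcs, and an entry equal to the identity gives a loop at
  every vertex.
\<close>

definition cayley_digraph ::
    "('a, 'm) monoid_scheme \<Rightarrow> 'a list \<Rightarrow> ('a, 'a \<times> nat) Digraph.pre_digraph" where
  "cayley_digraph G S =
     \<lparr> verts = carrier G,
       arcs = carrier G \<times> {..<length S},
       tail = fst,
       head = (\<lambda>(x, i). x \<otimes>\<^bsub>G\<^esub> S ! i) \<rparr>"

lemma fin_digraph_cayley_digraph:
  assumes "group G" "finite (carrier G)" "set S \<subseteq> carrier G"
  shows "fin_digraph (cayley_digraph G S)"
proof -
  interpret group G by fact
  have "S ! i \<in> carrier G" if "i < length S" for i
    using that assms(3) nth_mem by blast
  then show ?thesis
    using assms(2) by unfold_locales (auto simp: cayley_digraph_def)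
qed

text \<open>
  A cycle in the sense of \<open>pre_digraph.cycle\<close> is a nonempty closed directed walk without repeated
  vertices (apart from its endpoints); loops and directed 2-cycles are included. The girth of an
  acyclic digraph is \<open>\<infinity>\<close>, being the infimum of the empty set in \<^typ>\<open>enat\<close>.
\<close>

definition girth :: "('a, 'b) Digraph.pre_digraph \<Rightarrow> enat" where
  "girth D = (INF p \<in> {p. pre_digraph.cycle D p}. enat (length p))"

end

theory Submission
  imports Defs "HOL-Real_Asymp.Real_Asymp"
begin

text \<open>
  A directed cycle of length \<open>l\<close> spells a nonempty positive word \<open>w\<close> of length \<open>l\<close> in the \<open>k\<close>
  generators that evaluates to the identity, so a union bound over the at most
  \<open>k ^ (L + 1)\<close> words of length at most \<open>L\<close> reduces the theorem to an upper bound on the probability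
  that a fixed word \<open>w\<close> is a relator of a random tuple \<open>S\<close>.

  For this bound the permutations are revealed one value at a time. Take a point \<open>x\<close> that is not yet
  a revealed value of any of them, and follow the trajectory of \<open>x\<close> under the successive letters of
  \<open>w\<close>. If \<open>w\<close> acts as the identity, then the trajectory returns to \<open>x\<close>. Its first return must occur
  at a newly revealed value, because no value revealed before is \<open>x\<close>, and a newly revealed
  value equals \<open>x\<close> with probability at most \<open>1 / d\<close> as long as at least \<open>d\<close> points are
  not yet revealed values. So the trajectory returns with probability at most \<open>l / d\<close>. It does not matter that
  the trajectory meets other revealed points on its way; only meeting \<open>x\<close> counts, and this is where
  positivity of the word is used: a word with inverse letters could come back to \<open>x\<close> along the edge
  by which it left.

  The trajectory reveals at most \<open>l\<close> values, so the experiment can be repeated with \<open>t\<close> fresh starting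
  points whenever \<open>d + t * l \<le> n\<close>, and \<open>w\<close> is a relator with probability at most \<open>(l / d) ^ t\<close>
  (\<open>prob_relator_le\<close>; the inductive step is \<open>card_first_return\<close>). Put
  \<open>\<rho> = c * sqrt (n * ln n / ln k)\<close>, an upper bound for \<open>c * sqrt (log k (n!))\<close>. With \<open>l \<le> \<rho>\<close>,
  \<open>t\<close> about \<open>n / (2 * \<rho>)\<close> and \<open>d\<close> about \<open>n / 2\<close>, this bound is about
  \<open>(2 * \<rho> / n) powr (n / (2 * \<rho>))\<close>. Its logarithm is asymptotically
  \<open>- sqrt (n * ln n * ln k) / (4 * c)\<close>, while the logarithm of the number of words is about
  \<open>c * sqrt (n * ln n * ln k)\<close>. Hence every \<open>c < 1/2\<close> works, and the proof takes \<open>c = 1/4\<close>.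

  Probabilities conditional on the revealed values are expressed as cardinalities: all
  tuples are equally likely, and the condition is membership in \<open>extensions k V E\<close>.
\<close>

section \<open>Tuples of permutations with prescribed values\<close>

text \<open>
  A triple \<open>(i, y, z)\<close> in \<open>E\<close> is a revealed value: the permutation with index \<open>i\<close> maps \<open>y\<close> to \<open>z\<close>.
  Accordingly \<open>snd ` snd ` E\<close> below is the set of all revealed values, and a point outside it is
  fresh. The set \<open>E\<close> may be contradictory, in which case there are no extensions and the estimates
  hold trivially; this spares a separate treatment of steps along edges already revealed.
\<close>

definition extensions :: "nat \<Rightarrow> 'a set \<Rightarrow> (nat \<times> 'a \<times> 'a) set \<Rightarrow> ('a \<Rightarrow> 'a) list set" where
  "extensions k V E = {S. length S = k \<and> set S \<subseteq> {p. p permutes V} \<and> (\<forall>(i, y, z)\<in>E. (S ! i) y = z)}"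

lemma finite_extensions: "finite V \<Longrightarrow> finite (extensions k V E)"
  by (rule finite_subset[OF _ finite_lists_length_eq[OF finite_permutations[of V], of k]])
     (auto simp: extensions_def)

lemma extensions_insert:
  "extensions k V (insert (i, y, z) E) = {S \<in> extensions k V E. (S ! i) y = z}"
  by (auto simp: extensions_def)

lemma extensions_permutes: "S \<in> extensions k V E \<Longrightarrow> i < k \<Longrightarrow> (S ! i) permutes V"
  unfolding extensions_def by (auto dest!: nth_mem)

lemma card_split_by_image:
  assumes "finite V" "i < k" "y \<in> V"
  shows "card {S \<in> extensions k V E. P S}
       = (\<Sum>z\<in>V. card {S \<in> extensions k V (insert (i, y, z) E). P S})"
proof -
  have "{S \<in> extensions k V E. P S} = (\<Union>z\<in>V. {S \<in> extensions k V (insert (i, y, z) E). P S})"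
    using assms by (auto simp: extensions_insert permutes_in_image[OF extensions_permutes])
  moreover have "card \<dots> = (\<Sum>z\<in>V. card {S \<in> extensions k V (insert (i, y, z) E). P S})"
    using assms by (intro card_UN_disjoint) (auto simp: finite_extensions, auto simp: extensions_insert)
  ultimately show ?thesis by simp
qed

text \<open>
  Composing the permutation \<open>S ! i\<close> with the transposition of two fresh values exchanges them as
  images of \<open>y\<close> and leaves every prescribed value unchanged. Hence all fresh values are equally
  likely images.
\<close>

lemma card_extensions_fresh_swap:
  assumes "finite V" "i < k" "x \<in> V" "z \<in> V" "x \<notin> snd ` snd ` E" "z \<notin> snd ` snd ` E"
  shows "card (extensions k V (insert (i, y, x) E)) \<le> card (extensions k V (insert (i, y, z) E))"
proof (rule card_inj_on_le)
  let ?f = "\<lambda>S. S[i := Transposition.transpose x z \<circ> S ! i]"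
  show "inj_on ?f (extensions k V (insert (i, y, x) E))"
  proof (rule inj_on_inverseI)
    fix S assume "S \<in> extensions k V (insert (i, y, x) E)"
    then have "length S = k" by (simp add: extensions_def)
    then show "?f (?f S) = S"
      using assms(2) by (simp add: o_assoc transpose_comp_involutory)
  qed
  show "?f ` extensions k V (insert (i, y, x) E) \<subseteq> extensions k V (insert (i, y, z) E)"
  proof clarify
    fix S assume S: "S \<in> extensions k V (insert (i, y, x) E)"
    then have len: "length S = k" and sub: "set S \<subseteq> {p. p permutes V}"
      by (auto simp: extensions_def)
    have "Transposition.transpose x z \<circ> S ! i permutes V"
      using assms S by (intro permutes_compose permutes_swap_id extensions_permutes)
    then have "set (?f S) \<subseteq> {p. p permutes V}"
      using sub set_update_subset_insert[of S i] by fastforce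
    moreover have "(?f S ! j) y' = z'" if e: "(j, y', z') \<in> E" for j y' z'
    proof -
      have "(S ! j) y' = z'" using S e by (auto simp: extensions_def)
      moreover have "z' \<noteq> x" "z' \<noteq> z" using assms(5,6) e by force+
      ultimately show ?thesis
        using assms(2) len by (cases "j = i") auto
    qed
    moreover have "(?f S ! i) y = z"
      using S assms(2) len by (auto simp: extensions_def)
    ultimately show "?f S \<in> extensions k V (insert (i, y, z) E)"
      using len by (auto simp: extensions_def)
  qed
qed (simp add: finite_extensions assms)

text \<open>
  There are at least \<open>card V - card E\<close> equally likely fresh images, so a particular one has
  conditional probability at most \<open>1 / (card V - card E)\<close>.
\<close>

lemma card_extensions_fresh:
  assumes "finite V" "finite E" "i < k" "y \<in> V" "x \<in> V" "x \<notin> snd ` snd ` E"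
  shows "(card V - card E) * card (extensions k V (insert (i, y, x) E)) \<le> card (extensions k V E)"
proof -
  have "card (snd ` snd ` E) \<le> card E"
    using assms(2) by (meson card_image_le finite_imageI order_trans)
  then have "card V - card E \<le> card (V - snd ` snd ` E)"
    using diff_card_le_card_Diff[of "snd ` snd ` E" V] assms(2) by simp
  then have "(card V - card E) * card (extensions k V (insert (i, y, x) E))
      \<le> (\<Sum>z\<in>V - snd ` snd ` E. card (extensions k V (insert (i, y, x) E)))"
    by simp
  also have "\<dots> \<le> (\<Sum>z\<in>V - snd ` snd ` E. card (extensions k V (insert (i, y, z) E)))"
    using assms by (intro sum_mono card_extensions_fresh_swap) auto
  also have "\<dots> \<le> (\<Sum>z\<in>V. card (extensions k V (insert (i, y, z) E)))"
    using assms(1) by (intro sum_mono2) auto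
  also have "\<dots> = card (extensions k V E)"
    using card_split_by_image[of V i k y E "\<lambda>_. True"] assms by simp
  finally show ?thesis .
qed

section \<open>Words that act as the identity\<close>

text \<open>
  The first return argument, together with the continuation after it. A trajectory stands at
  \<open>y\<close> and still has to follow \<open>u\<close>; the point \<open>x\<close> is fresh. Each of the remaining steps is the
  first one to hit \<open>x\<close> with probability at most \<open>1 / d\<close>. Given that it is, the values revealed so
  far number at most \<open>B\<close>, so that \<open>R\<close> still has conditional probability at most
  \<open>C / D\<close> by hypothesis. Stating the bound for the conjunction with an arbitrary \<open>R\<close> replaces a
  product rule for probabilities at the random time of first return. The last premise
  excludes the one case of a return without a step; for nonempty \<open>u\<close> the trajectory may start at
  \<open>x\<close> itself.
\<close>

lemma card_first_return:
  assumes V: "finite V" and dB: "d + B \<le> card V"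
  assumes R: "\<And>E. finite E \<Longrightarrow> card E \<le> B \<Longrightarrow>
      card {S \<in> extensions k V E. R S} * D \<le> C * card (extensions k V E)"
  assumes "set u \<subseteq> {..<k}" "finite E" "card E + length u \<le> B"
    and x: "x \<in> V" and "x \<notin> snd ` snd ` E" "y \<in> V" "u = [] \<Longrightarrow> y \<noteq> x"
  shows "card {S \<in> extensions k V E. fold ((!) S) u y = x \<and> R S} * (d * D)
       \<le> length u * C * card (extensions k V E)"
  using assms(4-)
proof (induction u arbitrary: E y)
  case Nil
  then show ?case by simp
next
  case (Cons i u)
  let ?X = "\<lambda>z. extensions k V (insert (i, y, z) E)"
  let ?N = "\<lambda>z. card {S \<in> ?X z. fold ((!) S) (i # u) y = x \<and> R S}"
  have i: "i < k" using Cons.prems by simp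
  have card_ins: "card (insert (i, y, z) E) \<le> Suc (card E)" for z
    using Cons.prems by (simp add: card_insert_if)
  \<comment> \<open>The first step hits \<open>x\<close>: the rest of the trajectory is ignored, only \<open>R\<close> is kept.\<close>
  have hit: "?N x * (d * D) \<le> C * card (extensions k V E)"
  proof -
    have "?N x * (d * D) \<le> card {S \<in> ?X x. R S} * (d * D)"
      by (intro mult_right_mono card_mono) (auto simp: finite_extensions V)
    also have "\<dots> = card {S \<in> ?X x. R S} * D * d" by simp
    also have "\<dots> \<le> C * card (?X x) * d"
      using card_ins[of x] Cons.prems by (intro mult_right_mono R) auto
    also have "\<dots> = C * (d * card (?X x))" by simp
    also have "\<dots> \<le> C * ((card V - card E) * card (?X x))"
      using Cons.prems dB by (intro mult_left_mono mult_right_mono) auto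
    also have "\<dots> \<le> C * card (extensions k V E)"
      using Cons.prems V i by (intro mult_left_mono card_extensions_fresh) auto
    finally show ?thesis .
  qed
  \<comment> \<open>The first step goes elsewhere: \<open>x\<close> stays fresh, and the trajectory continues from \<open>z\<close>.\<close>
  have miss: "?N z * (d * D) \<le> length u * C * card (?X z)" if z: "z \<in> V - {x}" for z
  proof -
    have "?N z = card {S \<in> ?X z. fold ((!) S) u z = x \<and> R S}"
      by (rule arg_cong[where f = card]) (auto simp: extensions_insert)
    also have "\<dots> * (d * D) \<le> length u * C * card (?X z)"
      using Cons.prems z card_ins[of z] by (intro Cons.IH) auto
    finally show ?thesis .
  qed
  have "card {S \<in> extensions k V E. fold ((!) S) (i # u) y = x \<and> R S} * (d * D)
      = (\<Sum>z\<in>V. ?N z * (d * D))"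
    using Cons.prems V i by (subst card_split_by_image[of V i k y]) (auto simp: sum_distrib_right)
  also have "\<dots> = ?N x * (d * D) + (\<Sum>z\<in>V - {x}. ?N z * (d * D))"
    using V x by (simp add: sum.remove)
  also have "\<dots> \<le> C * card (extensions k V E) + (\<Sum>z\<in>V - {x}. length u * C * card (?X z))"
    by (intro add_mono hit sum_mono miss)
  also have "(\<Sum>z\<in>V - {x}. length u * C * card (?X z)) \<le> (\<Sum>z\<in>V. length u * C * card (?X z))"
    using V by (intro sum_mono2) auto
  also have "\<dots> = length u * C * card (extensions k V E)"
    using card_split_by_image[of V i k y E "\<lambda>_. True"] Cons.prems V i
    by (simp add: sum_distrib_left)
  finally show ?case by (simp add: algebra_simps)
qed

text \<open>
  Conditionally on \<open>E\<close>, a relator has probability at most \<open>(length w / d) ^ t\<close>. Each round applies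
  the first return bound to the whole trajectory of a fresh point, with the event that \<open>w\<close> is a
  relator as \<open>R\<close>, so that the remaining rounds are supplied by the induction hypothesis.
\<close>

lemma card_relator_extensions:
  assumes "finite V" "set w \<subseteq> {..<k}" "w \<noteq> []" "0 < d"
    and "finite E" "d + card E + t * length w \<le> card V"
  shows "card {S \<in> extensions k V E. fold ((!) S) w = id} * d ^ t
       \<le> length w ^ t * card (extensions k V E)"
  using assms(5-)
proof (induction t arbitrary: E)
  case 0
  then show ?case by (auto intro!: card_mono simp: finite_extensions assms)
next
  case (Suc t)
  have "card (snd ` snd ` E) \<le> card E"
    using Suc.prems(1) by (meson card_image_le finite_imageI order_trans)
  also have "\<dots> < card V" using Suc.prems assms(4) by simp
  finally have "\<not> V \<subseteq> snd ` snd ` E"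
    using Suc.prems(1) by (meson card_mono finite_imageI not_less)
  then obtain x where x: "x \<in> V" "x \<notin> snd ` snd ` E" by blast
  have "{S \<in> extensions k V E. fold ((!) S) w = id}
      = {S \<in> extensions k V E. fold ((!) S) w x = x \<and> fold ((!) S) w = id}"
    by auto
  also have "card \<dots> * (d * d ^ t) \<le> length w * length w ^ t * card (extensions k V E)"
    using Suc.prems assms x
    by (intro card_first_return[where B = "card E + length w"] Suc.IH) auto
  finally show ?case by (simp only: power_Suc)
qed

section \<open>From counting to probability\<close>

lemma pmf_replicate_pmf:
  "pmf (replicate_pmf k p) xs = (if length xs = k then prod_list (map (pmf p) xs) else 0)"
proof (induction k arbitrary: xs)
  case 0
  then show ?case by (auto simp: pmf_return)
next
  case (Suc k)
  have eq: "replicate_pmf (Suc k) p = map_pmf (\<lambda>(x, xs). x # xs) (pair_pmf p (replicate_pmf k p))"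
    by (simp add: pair_pmf_def map_bind_pmf)
  show ?case
  proof (cases xs)
    case Nil
    then have "xs \<notin> set_pmf (replicate_pmf (Suc k) p)" unfolding set_replicate_pmf by simp
    then show ?thesis using Nil by (simp add: set_pmf_iff del: replicate_pmf.simps)
  next
    case (Cons y ys)
    have "pmf (replicate_pmf (Suc k) p) ((\<lambda>(x, xs). x # xs) (y, ys))
        = pmf (pair_pmf p (replicate_pmf k p)) (y, ys)"
      unfolding eq by (rule pmf_map_inj') (auto simp: inj_def)
    then show ?thesis using Cons Suc by (simp add: pmf_pair del: replicate_pmf.simps)
  qed
qed

lemma replicate_pmf_of_set:
  assumes "finite A" "A \<noteq> {}"
  shows "replicate_pmf k (pmf_of_set A) = pmf_of_set {xs. set xs \<subseteq> A \<and> length xs = k}"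
proof (rule pmf_eqI)
  fix xs :: "'a list"
  let ?L = "{xs. set xs \<subseteq> A \<and> length xs = k}"
  have fin: "finite ?L" using assms(1) by (rule finite_lists_length_eq)
  obtain a where "a \<in> A" using assms(2) by blast
  then have "replicate k a \<in> ?L" by auto
  then have ne: "?L \<noteq> {}" by blast
  have "prod_list (map (pmf (pmf_of_set A)) xs) = (if set xs \<subseteq> A then 1 / card A ^ length xs else 0)"
    using assms by (induction xs) (auto simp: indicator_def)
  then show "pmf (replicate_pmf k (pmf_of_set A)) xs = pmf (pmf_of_set ?L) xs"
    using fin ne assms(1)
    by (auto simp: pmf_replicate_pmf card_lists_length_eq indicator_def)
qed

lemma prob_relator_le:
  assumes "finite V" "set w \<subseteq> {..<k}" "w \<noteq> []" "0 < d" "d + t * length w \<le> card V"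
  shows "measure_pmf.prob (replicate_pmf k (pmf_of_set {p. p permutes V})) {S. fold ((!) S) w = id}
       \<le> (real (length w) / real d) ^ t"
proof -
  let ?X = "extensions k V {}"
  have X: "?X = {S. set S \<subseteq> {p. p permutes V} \<and> length S = k}"
    by (auto simp: extensions_def)
  have "replicate k id \<in> ?X" by (auto simp: extensions_def permutes_id)
  then have ne: "?X \<noteq> {}" by blast
  have fin: "finite ?X" by (rule finite_extensions) fact
  have pos: "card ?X > 0" using ne fin by (simp add: card_gt_0_iff)
  have perms: "{p. p permutes V} \<noteq> {}" using permutes_id by blast
  have unif: "replicate_pmf k (pmf_of_set {p. p permutes V}) = pmf_of_set ?X"
    unfolding X using assms(1) perms by (intro replicate_pmf_of_set finite_permutations)
  have "measure_pmf.prob (pmf_of_set ?X) {S. fold ((!) S) w = id}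
      = real (card {S \<in> ?X. fold ((!) S) w = id}) / real (card ?X)"
    using ne fin by (simp add: measure_pmf_of_set Int_def)
  also have "\<dots> \<le> (real (length w) / real d) ^ t"
  proof -
    have "card {S \<in> ?X. fold ((!) S) w = id} * d ^ t \<le> length w ^ t * card ?X"
      using assms by (intro card_relator_extensions) auto
    then have "real (card {S \<in> ?X. fold ((!) S) w = id} * d ^ t) \<le> real (length w ^ t * card ?X)"
      by (rule of_nat_mono)
    then show ?thesis
      using pos assms(4) by (simp add: power_divide divide_simps mult_ac)
  qed
  finally show ?thesis unfolding unif .
qed

section \<open>Cycles in the Cayley digraph of the symmetric group\<close>

text \<open>
  The labels appear in reverse order: arcs multiply on the right, and a product of permutations
  applies its last factor first.
\<close>

lemma walk_in_cayley_digraph_sym_group: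
  assumes "pre_digraph.cas (cayley_digraph (sym_group n) S) u p v"
  shows "v = u \<circ> fold ((!) S) (rev (map snd p))"
  using assms
proof (induction p arbitrary: u)
  case Nil
  then show ?case by (simp add: pre_digraph.cas.simps)
next
  case (Cons e p)
  then show ?case
    by (fastforce simp: pre_digraph.cas.simps cayley_digraph_def sym_group_mult o_assoc case_prod_beta)
qed

lemma relator_of_cycle:
  assumes "pre_digraph.cycle (cayley_digraph (sym_group n) S) p"
  obtains w where "set w \<subseteq> {..<length S}" "w \<noteq> []" "length w = length p" "fold ((!) S) w = id"
proof -
  let ?D = "cayley_digraph (sym_group n) S"
  obtain u where u: "u \<in> carrier (sym_group n)" and arcs: "set p \<subseteq> arcs ?D"
    and cas: "pre_digraph.cas ?D u p u" and "p \<noteq> []"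
    using assms by (auto simp: pre_digraph.cycle_def pre_digraph.awalk_def cayley_digraph_def)
  let ?w = "rev (map snd p)"
  have "u = u \<circ> fold ((!) S) ?w"
    using cas by (rule walk_in_cayley_digraph_sym_group)
  then have "inv_into UNIV u \<circ> u = (inv_into UNIV u \<circ> u) \<circ> fold ((!) S) ?w"
    by (simp add: comp_assoc)
  then have "fold ((!) S) ?w = id"
    using u by (simp add: sym_group_carrier permutes_inv_o)
  moreover have "set ?w \<subseteq> {..<length S}"
    using arcs by (auto simp: cayley_digraph_def)
  ultimately show ?thesis using \<open>p \<noteq> []\<close> that[of ?w] by simp
qed

text \<open>
  A finite girth is attained, since a nonempty set of extended natural numbers contains its infimum.
\<close>

lemma girth_not_greaterE:
  assumes "\<not> ereal_of_enat (girth D) > ereal r"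
  obtains p where "pre_digraph.cycle D p" "real (length p) \<le> r"
proof -
  let ?C = "{p. pre_digraph.cycle D p}"
  have le: "ereal_of_enat (girth D) \<le> ereal r" using assms by simp
  then have finite_girth: "girth D \<noteq> \<infinity>" by (cases "girth D") auto
  have "?C \<noteq> {}"
  proof
    assume empty: "?C = {}"
    have "girth D = \<infinity>" unfolding girth_def empty by (simp add: top_enat_def)
    with finite_girth show False ..
  qed
  then obtain q where "q \<in> ?C" by (meson ex_in_conv)
  then have "enat (length q) \<in> (\<lambda>p. enat (length p)) ` ?C" by (rule imageI)
  then have "girth D \<in> (\<lambda>p. enat (length p)) ` ?C"
    unfolding girth_def by (rule wellorder_InfI)
  then obtain p where "pre_digraph.cycle D p" "girth D = enat (length p)" by auto
  with le that show ?thesis by auto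
qed

section \<open>The union bound and its asymptotics\<close>

text \<open>
  The union bound over words of length at most \<open>\<lfloor>\<rho>\<rfloor>\<close>. The choice \<open>t = \<lfloor>n / (2 * \<rho>)\<rfloor>\<close> gives away at
  most half of the points to revealed values, which leaves \<open>d \<ge> n / 2\<close>. The exponent loses 1 to
  rounding down \<open>t\<close>, and the factor \<open>k\<close> accounts for the words shorter than \<open>\<lfloor>\<rho>\<rfloor>\<close>.
\<close>

lemma prob_girth_sym_group_le:
  fixes \<rho> r :: real
  assumes "k \<ge> 2" "r \<le> \<rho>" "0 < \<rho>" "2 * \<rho> \<le> real n"
  shows "measure_pmf.prob (replicate_pmf k (pmf_of_set (carrier (sym_group n))))
           {S. \<not> ereal_of_enat (girth (cayley_digraph (sym_group n) S)) > ereal r}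
       \<le> real k * exp (\<rho> * ln (real k)) * (2 * \<rho> / real n) powr (real n / (2 * \<rho>) - 1)"
proof -
  define L where "L = nat \<lfloor>\<rho>\<rfloor>"
  define t where "t = nat \<lfloor>real n / (2 * \<rho>)\<rfloor>"
  define d where "d = n - t * L"
  define W where "W = {w. set w \<subseteq> {..<k} \<and> length w \<le> L}"
  let ?M = "replicate_pmf k (pmf_of_set (carrier (sym_group n)))"
  let ?rel = "\<lambda>w. {S. fold ((!) S) w = (id :: nat \<Rightarrow> nat)}"
  have carrier: "carrier (sym_group n) = {p. p permutes {1..n}}"
    by (auto simp: sym_group_carrier)
  have n: "n > 0" using assms by (cases n) auto
  have L: "real L \<le> \<rho>" and t: "real t \<le> real n / (2 * \<rho>)" "real n / (2 * \<rho>) - 1 \<le> real t"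
    using assms(3) unfolding L_def t_def by (simp_all add: of_nat_nat)
  have "real (t * L) \<le> real n / (2 * \<rho>) * \<rho>"
    unfolding of_nat_mult using L t assms(3) by (intro mult_mono) auto
  then have tL: "real (t * L) \<le> real n / 2" using assms(3) by simp
  then have d: "real n / 2 \<le> real d" unfolding d_def by linarith
  then have "d > 0" using n by (cases d) auto
  have finW: "finite W" unfolding W_def by (rule finite_lists_length_le) simp
  have word: "measure_pmf.prob ?M (?rel w) \<le> (2 * \<rho> / real n) ^ t" if w: "w \<in> W - {[]}" for w
  proof -
    have "t * length w \<le> t * L" using w by (auto simp: W_def)
    moreover have "t * L \<le> n" using tL by linarith
    ultimately have "d + t * length w \<le> n" unfolding d_def by linarith
    then have "d + t * length w \<le> card {1..n}" by simp
    then have "measure_pmf.prob ?M (?rel w) \<le> (real (length w) / real d) ^ t"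
      unfolding carrier using w \<open>d > 0\<close> by (intro prob_relator_le) (auto simp: W_def)
    also have "\<dots> \<le> (\<rho> / (real n / 2)) ^ t"
      using w L d n assms(3) by (intro power_mono frac_le) (auto simp: W_def)
    finally show ?thesis by (simp add: mult.commute)
  qed
  have "card W = (\<Sum>l<Suc L. k ^ l)"
    unfolding W_def by (simp add: card_lists_length_le lessThan_Suc_atMost)
  also have "(\<Sum>l<m. k ^ l) \<le> k ^ m" for m
  proof (induction m)
    case (Suc m)
    have "2 * k ^ m \<le> k * k ^ m" using assms(1) by (intro mult_right_mono) auto
    with Suc show ?case unfolding sum.lessThan_Suc power_Suc by linarith
  qed simp
  finally have cardW: "card W \<le> k ^ Suc L" .
  \<comment> \<open>Only tuples of length \<open>k\<close> spell words over \<open>{..<k}\<close>, so the inclusion of events holds just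
    on the support of the distribution.\<close>
  have "AE S in ?M. S \<in> {S. \<not> ereal_of_enat (girth (cayley_digraph (sym_group n) S)) > ereal r}
      \<longrightarrow> S \<in> (\<Union>w\<in>W - {[]}. ?rel w)"
  proof (intro AE_pmfI impI)
    fix S assume "S \<in> set_pmf ?M"
    then have len: "length S = k" by (simp add: set_replicate_pmf)
    assume "S \<in> {S. \<not> ereal_of_enat (girth (cayley_digraph (sym_group n) S)) > ereal r}"
    then obtain p where p: "pre_digraph.cycle (cayley_digraph (sym_group n) S) p"
      "real (length p) \<le> r"
      by (auto elim: girth_not_greaterE)
    from p(1) obtain w where w: "set w \<subseteq> {..<k}" "w \<noteq> []" "length w = length p"
      "fold ((!) S) w = id"
      using len relator_of_cycle by metis
    have "length w \<le> L" unfolding L_def using w(3) p(2) assms(2) by linarith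
    then show "S \<in> (\<Union>w\<in>W - {[]}. ?rel w)" using w unfolding W_def by blast
  qed
  then have "measure_pmf.prob ?M {S. \<not> ereal_of_enat (girth (cayley_digraph (sym_group n) S)) > ereal r}
      \<le> measure_pmf.prob ?M (\<Union>w\<in>W - {[]}. ?rel w)"
    by (intro measure_pmf.finite_measure_mono_AE) auto
  also have "\<dots> \<le> (\<Sum>w\<in>W - {[]}. measure_pmf.prob ?M (?rel w))"
    using finW by (intro measure_pmf.finite_measure_subadditive_finite) auto
  also have "\<dots> \<le> (\<Sum>w\<in>W - {[]}. (2 * \<rho> / real n) ^ t)"
    by (intro sum_mono word)
  also have "\<dots> \<le> real (card W) * (2 * \<rho> / real n) ^ t"
    using finW assms(3) by (auto intro!: mult_right_mono card_mono)
  also have "\<dots> \<le> (real k * exp (\<rho> * ln (real k))) * (2 * \<rho> / real n) powr (real n / (2 * \<rho>) - 1)"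
  proof (rule mult_mono)
    have "real (card W) \<le> real k * real k ^ L"
      using of_nat_mono[OF cardW, where ?'a = real] by simp
    also have "real k ^ L = exp (real L * ln (real k))"
      using assms(1) by (simp add: exp_of_nat_mult)
    also have "real k * \<dots> \<le> real k * exp (\<rho> * ln (real k))"
      using L assms(1) by (intro mult_left_mono) (auto intro!: mult_right_mono)
    finally show "real (card W) \<le> real k * exp (\<rho> * ln (real k))" .
    have "(2 * \<rho> / real n) ^ t = (2 * \<rho> / real n) powr real t"
      using n assms(3) by (simp add: powr_realpow)
    also have "\<dots> \<le> (2 * \<rho> / real n) powr (real n / (2 * \<rho>) - 1)"
      using t n assms by (intro powr_mono') auto
    finally show "(2 * \<rho> / real n) ^ t \<le> (2 * \<rho> / real n) powr (real n / (2 * \<rho>) - 1)" .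
  qed (use assms in auto)
  finally show ?thesis .
qed

text \<open>
  Here \<open>a\<^sup>2\<close> stands for \<open>ln k\<close>. The logarithm of the number of words is \<open>a / 4\<close> times
  \<open>sqrt (n * ln n)\<close>, and that of the bound for a single word is asymptotically \<open>- a\<close> times it.
\<close>

lemma girth_bound_tendsto_0:
  fixes a \<kappa> :: real
  assumes "a > 0"
  defines "\<rho> \<equiv> \<lambda>n::nat. sqrt (real n * ln (real n)) / (4 * a)"
  shows "(\<lambda>n. \<kappa> * exp (\<rho> n * a\<^sup>2) * (2 * \<rho> n / real n) powr (real n / (2 * \<rho> n) - 1)) \<longlonglongrightarrow> 0"
proof -
  define s where "s n = sqrt (real n * ln (real n))" for n :: nat
  define h where "h n = a / 4 + (real n / (2 * \<rho> n) - 1) * ln (2 * \<rho> n / real n) / s n" for n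
  \<comment> \<open>The limit is written in the form that \<open>real_asymp\<close> computes.\<close>
  have "h \<longlonglongrightarrow> a / 4 - 1 / inverse a"
    unfolding h_def s_def \<rho>_def using assms(1) by real_asymp
  moreover have "1 / inverse a = a"
    using assms(1) by (simp add: field_simps)
  ultimately have "h \<longlonglongrightarrow> a / 4 - a"
    by (simp only:)
  moreover have "filterlim s at_top sequentially"
    unfolding s_def by real_asymp
  ultimately have "filterlim (\<lambda>n. h n * s n) at_bot sequentially"
    using assms(1) by (intro filterlim_tendsto_neg_mult_at_bot[of h "a / 4 - a"]) auto
  then have "(\<lambda>n. exp (h n * s n)) \<longlonglongrightarrow> 0"
    by (rule filterlim_compose[OF exp_at_bot])
  then have lim: "(\<lambda>n. \<kappa> * exp (h n * s n)) \<longlonglongrightarrow> 0"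
    by (rule tendsto_mult_right_zero)
  have "eventually (\<lambda>n. \<kappa> * exp (h n * s n)
      = \<kappa> * exp (\<rho> n * a\<^sup>2) * (2 * \<rho> n / real n) powr (real n / (2 * \<rho> n) - 1)) sequentially"
    using eventually_ge_at_top[of 2]
  proof eventually_elim
    case (elim n)
    have s: "s n > 0" and \<rho>: "\<rho> n = s n / (4 * a)"
      using elim by (simp_all add: s_def \<rho>_def)
    have pos: "2 * \<rho> n / real n > 0" using elim s assms(1) unfolding \<rho> by simp
    have "h n * s n = \<rho> n * a\<^sup>2 + (real n / (2 * \<rho> n) - 1) * ln (2 * \<rho> n / real n)"
    proof -
      have "h n * s n = a / 4 * s n + (real n / (2 * \<rho> n) - 1) * ln (2 * \<rho> n / real n)"
        unfolding h_def distrib_right using s by simp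
      also have "a / 4 * s n = \<rho> n * a\<^sup>2"
        unfolding \<rho> power2_eq_square using assms(1) by simp
      finally show ?thesis .
    qed
    then show ?case using pos by (auto simp: powr_def exp_add)
  qed
  then show ?thesis using lim by (rule Lim_transform_eventually[rotated])
qed

theorem theorem2:
  shows "\<exists>c::real. c > 0 \<and>
    (\<forall>k::nat. k \<ge> 2 \<longrightarrow>
      (\<lambda>n::nat. measure_pmf.prob
          (replicate_pmf k (pmf_of_set (carrier (sym_group n))))
          {S. ereal_of_enat (girth (cayley_digraph (sym_group n) S))
                > ereal (c * sqrt (log (real k) (real (order (sym_group n)))))})
        \<longlonglongrightarrow> 1)"
proof (intro exI[of _ "1/4"] conjI allI impI)
  fix k :: nat assume k: "k \<ge> 2"
  define a where "a = sqrt (ln (real k))"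
  define \<rho> where "\<rho> n = sqrt (real n * ln (real n)) / (4 * a)" for n :: nat
  define r where "r n = 1/4 * sqrt (log (real k) (real (order (sym_group n))))" for n :: nat
  let ?P = "\<lambda>n. measure_pmf.prob (replicate_pmf k (pmf_of_set (carrier (sym_group n))))"
  let ?large = "\<lambda>n. {S. ereal_of_enat (girth (cayley_digraph (sym_group n) S)) > ereal (r n)}"
  let ?b = "\<lambda>n. real k * exp (\<rho> n * a\<^sup>2) * (2 * \<rho> n / real n) powr (real n / (2 * \<rho> n) - 1)"
  have a: "a > 0" "a\<^sup>2 = ln (real k)" using k by (simp_all add: a_def)
  have r_le: "r n \<le> \<rho> n" if "n \<ge> 1" for n
  proof -
    have "real (order (sym_group n)) = fact n"
      by (simp add: order_def sym_group_card_carrier)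
    also have "ln \<dots> \<le> ln (real n ^ n)"
      using that fact_le_power[of n, where 'a = real] by (subst ln_le_cancel_iff) auto
    also have "\<dots> = real n * ln (real n)" using that by (simp add: ln_realpow)
    finally have "log (real k) (real (order (sym_group n))) \<le> real n * ln (real n) / a\<^sup>2"
      unfolding log_def a(2) using k by (intro divide_right_mono) auto
    then have "sqrt (log (real k) (real (order (sym_group n)))) \<le> sqrt (real n * ln (real n)) / a"
      using a(1) by (metis real_sqrt_le_mono real_sqrt_divide real_sqrt_abs abs_of_pos)
    then show ?thesis unfolding r_def \<rho>_def by simp
  qed
  have "eventually (\<lambda>n. 2 * \<rho> n \<le> real n) sequentially"
    unfolding \<rho>_def using a(1) by real_asymp
  then have ev: "eventually (\<lambda>n. 1 - ?b n \<le> ?P n (?large n)) sequentially"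
    using eventually_ge_at_top[of 2]
  proof eventually_elim
    case (elim n)
    have "0 < \<rho> n" unfolding \<rho>_def using elim a(1) by simp
    then have "?P n {S. \<not> ereal_of_enat (girth (cayley_digraph (sym_group n) S)) > ereal (r n)} \<le> ?b n"
      unfolding a(2) using elim k r_le by (intro prob_girth_sym_group_le) auto
    moreover have "{S. \<not> ereal_of_enat (girth (cayley_digraph (sym_group n) S)) > ereal (r n)}
        = UNIV - ?large n"
      by auto
    moreover have "?P n (UNIV - ?large n) = 1 - ?P n (?large n)"
      using measure_pmf.prob_compl[of "?large n"] by simp
    ultimately show ?case by simp
  qed
  have "(\<lambda>n. 1 - ?b n) \<longlonglongrightarrow> 1 - 0"
    unfolding \<rho>_def by (intro tendsto_diff tendsto_const girth_bound_tendsto_0 a)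
  then have "(\<lambda>n. ?P n (?large n)) \<longlonglongrightarrow> 1"
    using ev by (intro tendsto_sandwich[OF ev _ _ tendsto_const]) auto
  then show "(\<lambda>n. measure_pmf.prob (replicate_pmf k (pmf_of_set (carrier (sym_group n))))
      {S. ereal_of_enat (girth (cayley_digraph (sym_group n) S))
            > ereal (1/4 * sqrt (log (real k) (real (order (sym_group n)))))}) \<longlonglongrightarrow> 1"
    unfolding r_def .
qed simp

end
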